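(* Let $(X,d)$ be a compact metric space and let $f:X\to X$ be a continuous map. If $f$ is expanding and locally eventually onto, then $(X,f)$ has the periodic specification property.
   Context: Notation: $\mathbb N=\{0,1,2,\dots\}$, and $B(x,r)$ is the ball of center $x$ and radius $r$ in $(X,d)$. Locally eventually onto: for every nonempty open set $U\subset X$ there is $n\in\mathbb N$ with $f^n(U)=X$. Expanding: there are constants $\lambda>1$ and $\delta_0>0$ such that, for all $x,y,z\in X$, (1) $d(f(x),f(y))\ge\lambda\, d(x,y)$ whenever $d(x,y)<\delta_0$, and (2) $B(x,\delta_0)\cap f^{-1}(z)$ is a singleton whenever $d(f(x),z)<\delta_0$. Specification: for integers $b\ge a\ge 0$ let $f^{[a,b]}(x):=\{f^j(x): a\le j\le b\}$. A family of orbit segments $\{f^{[a_j,b_j]}(x_j)\}_{j=1}^n$ (with $x_j\in X$ and integers $0\le a_j\le b_j$) is an $N$-spaced specification if $a_i-b_{i-1}\ge N$ for $2\le i\le n$. It is $\varepsilon$-shadowed by $y\in X$ if $d(f^k(y),f^k(x_i))\le\varepsilon$ for all $a_i\le k\le b_i$ and $1\le i\le n$. The system $(X,f)$ has the specification property if for any $\varepsilon>0$ there is a constant $N=N(\varepsilon)$ such that any $N$-spaced specification $\{f^{[a_j,b_j]}(x_j)\}_{j=1}^n$ is $\varepsilon$-shadowed by some $y\in X$. If additionally $y$ can be chosen in such a way that $f^{b_n-a_1+N}(y)=y$, then $(X,f)$ has the periodic specification property. *)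

theory Defs
  imports "HOL-Analysis.Analysis"
begin

text \<open>
  The space is a subset \<open>X\<close> of a metric space type, with the induced metric. Only the behaviour
  of \<open>f\<close> on \<open>X\<close> matters, so balls, preimages and open sets are taken relative to \<open>X\<close>.
\<close>

definition locally_eventually_onto :: "'a::topological_space set \<Rightarrow> ('a \<Rightarrow> 'a) \<Rightarrow> bool" where
  "locally_eventually_onto X f \<longleftrightarrow>
     (\<forall>U. openin (top_of_set X) U \<and> U \<noteq> {} \<longrightarrow> (\<exists>n. (f ^^ n) ` U = X))"

definition expanding :: "'a::metric_space set \<Rightarrow> ('a \<Rightarrow> 'a) \<Rightarrow> bool" where
  "expanding X f \<longleftrightarrow>
     (\<exists>l>1. \<exists>\<delta>>0. \<forall>x\<in>X. \<forall>y\<in>X. \<forall>z\<in>X.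
        (dist x y < \<delta> \<longrightarrow> dist (f x) (f y) \<ge> l * dist x y) \<and>
        (dist (f x) z < \<delta> \<longrightarrow> is_singleton ((ball x \<delta> \<inter> X) \<inter> (f -` {z} \<inter> X))))"

text \<open>
  A family of \<open>n\<close> orbit segments is given by its data \<open>(a j, b j, x j)\<close> for \<open>j \<in> {1..n}\<close>;
  values at other indices are irrelevant. Families are nonempty, since \<open>a 1\<close> and \<open>b n\<close> enter
  the period below.
\<close>

definition spaced_specification ::
    "'a set \<Rightarrow> nat \<Rightarrow> nat \<Rightarrow> (nat \<Rightarrow> nat) \<Rightarrow> (nat \<Rightarrow> nat) \<Rightarrow> (nat \<Rightarrow> 'a) \<Rightarrow> bool" where
  "spaced_specification X N n a b x \<longleftrightarrow>
     1 \<le> n \<and> (\<forall>j\<in>{1..n}. x j \<in> X \<and> a j \<le> b j) \<and>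
     (\<forall>i\<in>{2..n}. int (a i) - int (b (i - 1)) \<ge> int N)"

definition shadows ::
    "('a::metric_space \<Rightarrow> 'a) \<Rightarrow> real \<Rightarrow> nat \<Rightarrow> (nat \<Rightarrow> nat) \<Rightarrow> (nat \<Rightarrow> nat) \<Rightarrow> (nat \<Rightarrow> 'a) \<Rightarrow> 'a \<Rightarrow> bool"
  where
  "shadows f \<epsilon> n a b x y \<longleftrightarrow>
     (\<forall>i\<in>{1..n}. \<forall>k\<in>{a i..b i}. dist ((f ^^ k) y) ((f ^^ k) (x i)) \<le> \<epsilon>)"

definition specification_property :: "'a::metric_space set \<Rightarrow> ('a \<Rightarrow> 'a) \<Rightarrow> bool" where
  "specification_property X f \<longleftrightarrow>
     (\<forall>\<epsilon>>0. \<exists>N. \<forall>n a b x. spaced_specification X N n a b x \<longrightarrow>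
        (\<exists>y\<in>X. shadows f \<epsilon> n a b x y))"

text \<open>
  The subtraction in the exponent does not truncate: in a spaced specification
  \<open>a 1 \<le> b 1 \<le> a 2 \<le> \<dots> \<le> b n\<close>.
\<close>

definition periodic_specification_property :: "'a::metric_space set \<Rightarrow> ('a \<Rightarrow> 'a) \<Rightarrow> bool" where
  "periodic_specification_property X f \<longleftrightarrow>
     (\<forall>\<epsilon>>0. \<exists>N. \<forall>n a b x. spaced_specification X N n a b x \<longrightarrow>
        (\<exists>y\<in>X. shadows f \<epsilon> n a b x y \<and> (f ^^ (b n - a 1 + N)) y = y))"

lemma periodic_specification_property_imp_specification_property:
  "periodic_specification_property X f \<Longrightarrow> specification_property X f"
  unfolding periodic_specification_property_def specification_property_def by meson

end

theory Submission
  imports Defs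
begin

text \<open>
  Points near the end of an orbit segment can be pulled back along it by the contracting inverse
  branches of \<open>f\<close>. By compactness there is an \<open>N\<close> such that \<open>f\<^sup>N\<close> maps every \<open>\<eta>\<close>-ball
  onto \<open>X\<close>, so that segments \<open>N\<close> apart can be linked backwards in time, starting from the
  last one, with an arbitrary prescribed endpoint. Taking as endpoint the initial point of the
  first segment gives a shadowing orbit that nearly closes up, and the pull-back along this orbit
  is a contraction of a closed ball, whose fixed point is the required periodic point.
\<close>

section \<open>Surjectivity, and the order of times in a specification\<close>

text \<open>The set \<open>X - {x}\<close> is relatively open, so some iterate maps it onto
  \<open>X\<close> and hits \<open>x\<close>. The one-point space is treated apart because this set
  is then empty.\<close>

lemma locally_eventually_onto_imp_surj:
  fixes X :: "'a::t1_space set"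
  assumes "locally_eventually_onto X f" "f ` X \<subseteq> X"
  shows "f ` X = X"
proof
  show "X \<subseteq> f ` X"
  proof
    fix x assume x: "x \<in> X"
    show "x \<in> f ` X"
    proof (cases "X = {x}")
      case True
      then show ?thesis using assms(2) by auto
    next
      case False
      have op: "openin (top_of_set X) (X - {x})"
        by (metis Diff_eq inf_commute openin_open open_Compl closed_singleton)
      then obtain n where n: "(f ^^ n) ` (X - {x}) = X"
        using assms(1) False x unfolding locally_eventually_onto_def by blast
      then obtain u where u: "u \<in> X" "u \<noteq> x" "(f ^^ n) u = x"
        using x by (metis DiffE imageE singletonI)
      \<comment> \<open>\<open>n = 0\<close> would give \<open>u = x\<close>.\<close>
      then obtain m where "n = Suc m" by (cases n) auto
      moreover have "(f ^^ m) u \<in> X"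
        using u(1) assms(2) by (induction m) auto
      ultimately show ?thesis using u(3) by auto
    qed
  qed
qed fact

lemma funpow_image_eq: "f ` X = X \<Longrightarrow> (f ^^ n) ` X = X"
  by (induction n) (simp, metis funpow.simps(2) image_comp)

lemma spaced_specification_gap:
  assumes "spaced_specification X N n a b x" "1 \<le> j" "Suc j \<le> n"
  shows "b j + N \<le> a (Suc j)"
proof -
  have "Suc j \<in> {2..n}" using assms(2,3) by simp
  then have "int N \<le> int (a (Suc j)) - int (b (Suc j - 1))"
    using assms(1) unfolding spaced_specification_def by blast
  then show ?thesis by simp
qed

text \<open>By induction along the gaps, upwards for \<open>a\<close> and downwards for
  \<open>b\<close>. All times of the specification thus lie in one window, whose length plus
  \<open>N\<close> is the period.\<close>

lemma spaced_specification_bounds: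
  assumes "spaced_specification X N n a b x" "i \<in> {1..n}"
  shows "a 1 \<le> a i" "b i \<le> b n"
proof -
  have ab: "a j \<le> b j" if "j \<in> {1..n}" for j
    using assms(1) that by (auto simp: spaced_specification_def)
  note gap = spaced_specification_gap[OF assms(1)]
  have "1 \<le> i" "i \<le> n" using assms(2) by auto
  have "i \<le> n \<longrightarrow> a 1 \<le> a i"
    using \<open>1 \<le> i\<close>
  proof (induction i rule: dec_induct)
    case (step j)
    then show ?case using ab[of j] gap[of j] by auto
  qed simp
  then show "a 1 \<le> a i" using \<open>i \<le> n\<close> by simp
  from \<open>i \<le> n\<close> show "b i \<le> b n"
  proof (induction rule: inc_induct)
    case (step j)
    then show ?case using ab[of "Suc j"] gap[of j] \<open>1 \<le> i\<close> by simp
  qed simp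
qed

section \<open>Inverse branches and the closing of orbits\<close>

locale expanding_map =
  fixes X :: "'a::metric_space set" and f :: "'a \<Rightarrow> 'a" and l \<delta> :: real
  assumes maps: "f ` X \<subseteq> X"
    and l: "1 < l" and \<delta>: "0 < \<delta>"
    and expand: "\<lbrakk>x \<in> X; y \<in> X; dist x y < \<delta>\<rbrakk> \<Longrightarrow> l * dist x y \<le> dist (f x) (f y)"
    and branch: "\<lbrakk>x \<in> X; z \<in> X; dist (f x) z < \<delta>\<rbrakk> \<Longrightarrow> \<exists>y\<in>X. dist x y < \<delta> \<and> f y = z"
begin

lemma funpow_in: "x \<in> X \<Longrightarrow> (f ^^ n) x \<in> X"
  using maps by (induction n) auto

text \<open>The target is pulled back one step at a time: \<open>branch\<close> supplies a preimage
  \<open>w\<close> within \<delta> of the orbit of \<open>x\<close>, which is again an admissible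
  target, and \<open>expand\<close> shows that each step divides the distance by at least
  \<open>l\<close>.\<close>

lemma funpow_pull_back:
  assumes "x \<in> X" "z \<in> X" "dist ((f ^^ n) x) z < \<delta>"
  shows "\<exists>y\<in>X. (f ^^ n) y = z \<and>
    (\<forall>j\<le>n. dist ((f ^^ j) x) ((f ^^ j) y) \<le> dist ((f ^^ n) x) z / l ^ (n - j))"
  using assms
proof (induction n arbitrary: z)
  case 0
  then show ?case by auto
next
  case (Suc n)
  obtain w where w: "w \<in> X" "dist ((f ^^ n) x) w < \<delta>" "f w = z"
    using branch[of "(f ^^ n) x" z] Suc.prems funpow_in by auto
  have le: "dist ((f ^^ n) x) w \<le> dist ((f ^^ Suc n) x) z / l"
    using expand[OF funpow_in[OF Suc.prems(1)] w(1,2)] l w(3)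
    by (simp add: field_simps)
  obtain y where y: "y \<in> X" "(f ^^ n) y = w"
    "\<And>j. j \<le> n \<Longrightarrow> dist ((f ^^ j) x) ((f ^^ j) y) \<le> dist ((f ^^ n) x) w / l ^ (n - j)"
    using Suc.IH[OF Suc.prems(1) w(1,2)] by blast
  have "dist ((f ^^ j) x) ((f ^^ j) y) \<le> dist ((f ^^ Suc n) x) z / l ^ (Suc n - j)"
    if j: "j \<le> Suc n" for j
  proof (cases "j = Suc n")
    case True
    then show ?thesis using y(2) w(3) by simp
  next
    case False
    then have "j \<le> n" using j by simp
    have "dist ((f ^^ j) x) ((f ^^ j) y) \<le> dist ((f ^^ n) x) w / l ^ (n - j)"
      using y(3) \<open>j \<le> n\<close> .
    also have "\<dots> \<le> dist ((f ^^ Suc n) x) z / l / l ^ (n - j)"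
      using le l by (intro divide_right_mono) auto
    finally show ?thesis using \<open>j \<le> n\<close> by (simp add: Suc_diff_le)
  qed
  then show ?case using y(1,2) w(3) by (intro bexI[of _ y]) auto
qed

text \<open>Read backwards, this makes the pull-back along an orbit a contraction, which is its use
  in \<open>closing\<close>.\<close>

lemma funpow_expand:
  assumes "x \<in> X" "y \<in> X" "\<And>j. j < n \<Longrightarrow> dist ((f ^^ j) x) ((f ^^ j) y) < \<delta>"
  shows "l ^ n * dist x y \<le> dist ((f ^^ n) x) ((f ^^ n) y)"
  using assms(3)
proof (induction n)
  case 0
  then show ?case by simp
next
  case (Suc n)
  have "l ^ Suc n * dist x y \<le> l * dist ((f ^^ n) x) ((f ^^ n) y)"
    using Suc l by (simp add: mult.assoc)
  also have "\<dots> \<le> dist ((f ^^ Suc n) x) ((f ^^ Suc n) y)"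
    using expand funpow_in assms(1,2) Suc.prems by simp
  finally show ?case .
qed

text \<open>Banach's fixed point theorem is applied to the inverse branch of \<open>f ^^ P\<close>
  along the orbit of \<open>t\<close>. The tolerance in \<open>near\<close> is what remains of the
  radius \<rho> once the image of the ball has shrunk into radius \<open>\<rho> / l\<close>.\<close>

lemma closing:
  assumes "complete X" "t \<in> X" "0 < P" "0 < \<rho>" "2 * \<rho> < \<delta>"
    and near: "dist ((f ^^ P) t) t \<le> \<rho> * (1 - 1 / l)"
  shows "\<exists>z\<in>X. (f ^^ P) z = z \<and> (\<forall>j\<le>P. dist ((f ^^ j) t) ((f ^^ j) z) \<le> \<rho>)"
proof -
  \<comment> \<open>The centre is the endpoint of the orbit, not \<open>t\<close>: pulling back
    starts there and leads to a neighbourhood of \<open>t\<close>.\<close>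
  define B where "B = X \<inter> cball ((f ^^ P) t) \<rho>"
  \<comment> \<open>\<open>0 < P\<close> enters here: one step of expansion already yields the
    contraction constant \<open>1 / l\<close>.\<close>
  have pow: "l \<le> l ^ P" "1 \<le> l ^ k" for k
    using l \<open>0 < P\<close> self_le_power[of l P] by auto
  have "\<exists>y\<in>X. (f ^^ P) y = z \<and>
      (\<forall>j\<le>P. dist ((f ^^ j) t) ((f ^^ j) y) \<le> dist ((f ^^ P) t) z / l ^ (P - j))"
    if "z \<in> B" for z
    using that assms(2,4,5) by (intro funpow_pull_back) (auto simp: B_def)
  then obtain g where g: "\<And>z. z \<in> B \<Longrightarrow> g z \<in> X" "\<And>z. z \<in> B \<Longrightarrow> (f ^^ P) (g z) = z"
    "\<And>z j. z \<in> B \<Longrightarrow> j \<le> P \<Longrightarrow>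
      dist ((f ^^ j) t) ((f ^^ j) (g z)) \<le> dist ((f ^^ P) t) z / l ^ (P - j)"
    by metis
  have g_near: "dist ((f ^^ j) t) ((f ^^ j) (g z)) \<le> \<rho>" if "z \<in> B" "j \<le> P" for z j
  proof -
    have "dist ((f ^^ P) t) z / l ^ (P - j) \<le> dist ((f ^^ P) t) z / 1"
      using pow(2) l by (intro divide_left_mono) auto
    also have "\<dots> \<le> \<rho>" using that by (auto simp: B_def)
    finally show ?thesis using g(3)[OF that] by linarith
  qed
  have "complete B"
    unfolding B_def using assms(1) by (simp add: complete_Int_closed)
  moreover have "B \<noteq> {}"
    using funpow_in[OF assms(2), of P] assms(4) unfolding B_def
    by (metis IntI centre_in_cball empty_iff less_imp_le)
  moreover have "0 \<le> 1 / l" "1 / l < 1" using l by auto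
  moreover have "g ` B \<subseteq> B"
  proof
    fix y assume "y \<in> g ` B"
    then obtain z where z: "z \<in> B" "y = g z" by auto
    have "dist t (g z) \<le> dist ((f ^^ P) t) z / l ^ P" using g(3)[OF z(1), of 0] by simp
    also have "\<dots> \<le> \<rho> / l"
      using z pow(1) l assms(4) by (intro frac_le) (auto simp: B_def)
    finally have "dist ((f ^^ P) t) (g z) \<le> \<rho> * (1 - 1 / l) + \<rho> / l"
      using near dist_triangle[of "(f ^^ P) t" "g z" t] by linarith
    also have "\<dots> = \<rho>" by (simp add: algebra_simps)
    finally show "y \<in> B" using g(1) z by (auto simp: B_def)
  qed
  \<comment> \<open>Both pulled-back orbits stay within \<rho> of that of \<open>t\<close>, hence
    within \<open>2 * \<rho> < \<delta>\<close> of each other, as \<open>funpow_expand\<close>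
    demands.\<close>
  moreover have "dist (g z) (g z') \<le> 1 / l * dist z z'" if "z \<in> B" "z' \<in> B" for z z'
  proof -
    have "dist ((f ^^ j) (g z)) ((f ^^ j) (g z')) < \<delta>" if "j < P" for j
      using g_near[of z j] g_near[of z' j] \<open>z \<in> B\<close> \<open>z' \<in> B\<close> that assms(5)
        dist_triangle3[of "(f ^^ j) (g z)" "(f ^^ j) (g z')" "(f ^^ j) t"] by simp
    then have "l ^ P * dist (g z) (g z') \<le> dist z z'"
      using funpow_expand[of "g z" "g z'" P] g that by auto
    moreover have "l * dist (g z) (g z') \<le> l ^ P * dist (g z) (g z')"
      using pow(1) by (intro mult_right_mono) auto
    ultimately show ?thesis using l by (simp add: field_simps)
  qed
  ultimately have "\<exists>!z\<in>B. g z = z"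
    by (rule Banach_fix)
  then obtain z where "z \<in> B" "g z = z" by blast
  then show ?thesis using g(1,2)[of z] g_near[of z] by auto
qed

section \<open>Linking orbit segments\<close>

text \<open>Finitely many balls of half the radius cover \<open>X\<close>, and one whose centre is
  near \<open>x\<close> lies inside the ball around \<open>x\<close>. Iterating beyond the time at
  which its image is \<open>X\<close> does no harm, since \<open>f\<close> is surjective on
  \<open>X\<close>.\<close>

lemma uniformly_onto:
  assumes "compact X" "locally_eventually_onto X f" "0 < \<eta>"
  obtains N where "0 < N" "\<And>x. x \<in> X \<Longrightarrow> (f ^^ N) ` (ball x \<eta> \<inter> X) = X"
proof -
  have surj: "(f ^^ k) ` X = X" for k
    using locally_eventually_onto_imp_surj[OF assms(2) maps]
    by (intro funpow_image_eq)
  have "\<exists>n. (f ^^ n) ` (ball x (\<eta> / 2) \<inter> X) = X" if "x \<in> X" for x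
  proof -
    have "openin (top_of_set X) (ball x (\<eta> / 2) \<inter> X)"
      by (metis openin_open open_ball inf_commute)
    moreover have "x \<in> ball x (\<eta> / 2) \<inter> X" using that assms(3) by simp
    ultimately show ?thesis using assms(2) unfolding locally_eventually_onto_def by blast
  qed
  then obtain n where n: "\<And>x. x \<in> X \<Longrightarrow> (f ^^ n x) ` (ball x (\<eta> / 2) \<inter> X) = X"
    by metis
  obtain C where C: "C \<subseteq> X" "finite C" "X \<subseteq> (\<Union>c\<in>C. ball c (\<eta> / 2))"
    using compactE_image[OF assms(1), of X "\<lambda>c. ball c (\<eta> / 2)"] assms(3) by force
  \<comment> \<open>The sum dominates every \<open>n c\<close> with \<open>c\<close> in
    \<open>C\<close>; \<open>Suc\<close> makes \<open>N\<close> positive, so that the period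
    \<open>b n - a 1 + N\<close> is positive even when \<open>b n = a 1\<close>.\<close>
  define N where "N = Suc (\<Sum>c\<in>C. n c)"
  have "(f ^^ N) ` (ball x \<eta> \<inter> X) = X" if x: "x \<in> X" for x
  proof
    show "(f ^^ N) ` (ball x \<eta> \<inter> X) \<subseteq> X" using funpow_in by blast
    obtain c where c: "c \<in> C" "dist c x < \<eta> / 2" using x C(3) by auto
    have "n c \<le> N" using c(1) C(2) by (simp add: N_def le_SucI member_le_sum)
    have "c \<in> X" using c(1) C(1) by blast
    then have "X = (f ^^ (N - n c)) ` (f ^^ n c) ` (ball c (\<eta> / 2) \<inter> X)"
      by (simp only: n surj)
    also have "\<dots> = (f ^^ N) ` (ball c (\<eta> / 2) \<inter> X)"
      using \<open>n c \<le> N\<close> by (simp add: image_comp funpow_add[symmetric])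
    also have "\<dots> \<subseteq> (f ^^ N) ` (ball x \<eta> \<inter> X)"
    proof (intro image_mono Int_mono subsetI order_refl)
      fix u assume "u \<in> ball c (\<eta> / 2)"
      then show "u \<in> ball x \<eta>" using c(2) dist_triangle3[of x u c] by simp
    qed
    finally show "X \<subseteq> (f ^^ N) ` (ball x \<eta> \<inter> X)" .
  qed
  then show ?thesis using that[of N] by (simp add: N_def)
qed

text \<open>Induction on the number of segments. Leaving the endpoint \<open>t\<close> arbitrary is
  what links them: a point \<open>v\<close> for the last segment is found first, and the orbit
  shadowing the earlier ones is then steered onto the orbit of \<open>v\<close>.\<close>

lemma shadow_with_endpoint:
  assumes "f ` X = X" "\<eta> < \<delta>"
    and onto: "\<And>x. x \<in> X \<Longrightarrow> (f ^^ N) ` (ball x \<eta> \<inter> X) = X"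
    and "spaced_specification X N n a b x" "t \<in> X"
  shows "\<exists>y\<in>X. (f ^^ (b n + N)) y = t \<and> shadows f \<eta> n a b x y"
proof -
  have surj: "(f ^^ k) ` X = X" for k
    using assms(1) by (rule funpow_image_eq)
  \<comment> \<open>Some \<open>s\<close> close to the end of the segment reaches \<open>t\<close>
    after \<open>N\<close> steps, and \<open>s\<close> is pulled back along the whole orbit of
    \<open>u\<close>, down to time 0.\<close>
  have single: "\<exists>y\<in>X. (f ^^ (m + N)) y = t \<and> (\<forall>k\<le>m. dist ((f ^^ k) y) ((f ^^ k) u) \<le> \<eta>)"
    if u: "u \<in> X" and "t \<in> X" for u t m
  proof -
    have "t \<in> (f ^^ N) ` (ball ((f ^^ m) u) \<eta> \<inter> X)"
      using onto funpow_in that by simp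
    then obtain s where s: "s \<in> X" "dist ((f ^^ m) u) s < \<eta>" "(f ^^ N) s = t" by auto
    then obtain y where y: "y \<in> X" "(f ^^ m) y = s"
      "\<And>k. k \<le> m \<Longrightarrow> dist ((f ^^ k) u) ((f ^^ k) y) \<le> dist ((f ^^ m) u) s / l ^ (m - k)"
      using funpow_pull_back[OF u s(1) less_trans[OF s(2) assms(2)]] by blast
    have "dist ((f ^^ k) y) ((f ^^ k) u) \<le> \<eta>" if "k \<le> m" for k
    proof -
      have "dist ((f ^^ m) u) s / l ^ (m - k) \<le> dist ((f ^^ m) u) s / 1"
        using l by (intro divide_left_mono) auto
      then show ?thesis using y(3)[OF that] s(2) by (simp add: dist_commute)
    qed
    moreover have "(f ^^ (m + N)) y = t"
      using y(2) s(3) by (simp add: add.commute[of m] funpow_add)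
    ultimately show ?thesis using y(1) by blast
  qed
  have "1 \<le> n" using assms(4) by (simp add: spaced_specification_def)
  then show ?thesis using assms(4,5)
  proof (induction n arbitrary: t rule: dec_induct)
    case base
    then show ?case using single[of "x 1" t "b 1"]
      by (auto simp: shadows_def spaced_specification_def)
  next
    case (step n)
    have spec: "spaced_specification X N n a b x" and x: "x (Suc n) \<in> X"
      and gap: "b n + N \<le> a (Suc n)"
      using step.prems(1) step.hyps(1) spaced_specification_gap[OF step.prems(1), of n]
      by (auto simp: spaced_specification_def)
    obtain v where v: "v \<in> X" "(f ^^ (b (Suc n) + N)) v = t"
      "\<And>k. k \<le> b (Suc n) \<Longrightarrow> dist ((f ^^ k) v) ((f ^^ k) (x (Suc n))) \<le> \<eta>"
      using single[OF x step.prems(2), of "b (Suc n)"] by blast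
    \<comment> \<open>The point \<open>t'\<close> is to be reached at time \<open>b n + N\<close>.
      The iterate accounts for the excess of the gap over \<open>N\<close>, so that passing through
      \<open>t'\<close> then means meeting the orbit of \<open>v\<close> at time
      \<open>a (Suc n)\<close>.\<close>
    have "(f ^^ a (Suc n)) v \<in> (f ^^ (a (Suc n) - (b n + N))) ` X"
      using surj funpow_in v(1) by simp
    then obtain t' where t': "t' \<in> X"
      "(f ^^ (a (Suc n) - (b n + N))) t' = (f ^^ a (Suc n)) v" by auto
    obtain y where y: "y \<in> X" "(f ^^ (b n + N)) y = t'" "shadows f \<eta> n a b x y"
      using step.IH[OF spec t'(1)] by blast
    have at_a: "(f ^^ a (Suc n)) y = (f ^^ a (Suc n)) v"
      using t'(2) gap funpow_add[of "a (Suc n) - (b n + N)" "b n + N" f]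
      by (simp add: y(2)[symmetric])
    have later: "(f ^^ k) y = (f ^^ k) v" if "a (Suc n) \<le> k" for k
      using that at_a funpow_add[of "k - a (Suc n)" "a (Suc n)" f] by simp
    have "a (Suc n) \<le> b (Suc n)"
      using step.prems(1) by (simp add: spaced_specification_def)
    then have "(f ^^ (b (Suc n) + N)) y = t" using later v(2) by simp
    moreover have "shadows f \<eta> (Suc n) a b x y"
      using y(3) v(3) later by (auto simp: shadows_def atLeastAtMostSuc_conv)
    ultimately show ?case using y(1) by blast
  qed
qed

end

section \<open>Assembling the periodic shadowing orbit\<close>

theorem theorem2:
  fixes X :: "'a::metric_space set" and f :: "'a \<Rightarrow> 'a"
  assumes "compact X"
    and "f ` X \<subseteq> X"
    and "continuous_on X f"
    and "expanding X f"
    and "locally_eventually_onto X f"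
  shows "periodic_specification_property X f"
  unfolding periodic_specification_property_def
proof (intro allI impI)
  fix \<epsilon> :: real assume "0 < \<epsilon>"
  obtain l \<delta> where l\<delta>: "1 < l" "0 < \<delta>"
    and ex: "\<And>x y z. x \<in> X \<Longrightarrow> y \<in> X \<Longrightarrow> z \<in> X \<Longrightarrow>
      (dist x y < \<delta> \<longrightarrow> dist (f x) (f y) \<ge> l * dist x y) \<and>
      (dist (f x) z < \<delta> \<longrightarrow> is_singleton ((ball x \<delta> \<inter> X) \<inter> (f -` {z} \<inter> X)))"
    using assms(4) unfolding expanding_def by blast
  interpret expanding_map X f l \<delta>
  proof
    show "\<exists>y\<in>X. dist x y < \<delta> \<and> f y = z" if "x \<in> X" "z \<in> X" "dist (f x) z < \<delta>" for x z
    proof -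
      have "is_singleton ((ball x \<delta> \<inter> X) \<inter> (f -` {z} \<inter> X))"
        using ex that by blast
      then obtain y where "(ball x \<delta> \<inter> X) \<inter> (f -` {z} \<inter> X) = {y}"
        by (rule is_singletonE)
      then have "y \<in> (ball x \<delta> \<inter> X) \<inter> (f -` {z} \<inter> X)" by simp
      then show ?thesis by auto
    qed
  qed (use ex l\<delta> assms(2) in auto)
  \<comment> \<open>\<rho> is the radius for \<open>closing\<close>, which asks for
    \<open>2 * \<rho> < \<delta>\<close>, and \<eta> is its tolerance. The errors of linking and
    closing add up to at most \<open>\<eta> + \<rho>\<close>, hence to at most \<epsilon>.\<close>
  define \<rho> where "\<rho> = min \<epsilon> \<delta> / 3"
  define \<eta> where "\<eta> = \<rho> * (1 - 1 / l)"
  have \<rho>: "0 < \<rho>" "2 * \<rho> < \<delta>" "2 * \<rho> \<le> \<epsilon>"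
    using \<open>0 < \<epsilon>\<close> \<delta> by (auto simp: \<rho>_def)
  have \<eta>: "0 < \<eta>" "\<eta> \<le> \<rho>"
    using \<rho>(1) l by (auto simp: \<eta>_def field_simps)
  obtain N where N: "0 < N" "\<And>x. x \<in> X \<Longrightarrow> (f ^^ N) ` (ball x \<eta> \<inter> X) = X"
    using uniformly_onto[OF assms(1,5) \<eta>(1)] by blast
  show "\<exists>N. \<forall>n a b x. spaced_specification X N n a b x \<longrightarrow>
        (\<exists>y\<in>X. shadows f \<epsilon> n a b x y \<and> (f ^^ (b n - a 1 + N)) y = y)"
  proof (intro exI[of _ N] allI impI)
    fix n a b and x :: "nat \<Rightarrow> 'a"
    assume spec: "spaced_specification X N n a b x"
    note bounds = spaced_specification_bounds[OF spec]
    have one: "1 \<in> {1..n}" and x1: "x 1 \<in> X" "a 1 \<le> b 1"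
      using spec by (auto simp: spaced_specification_def)
    have ab: "a 1 \<le> b n" using x1(2) bounds(2)[OF one] by simp
    define P where "P = b n - a 1 + N"
    have "0 < P" using N(1) by (simp add: P_def)
    \<comment> \<open>With this endpoint the orbit of \<open>y\<close> hits the initial point of the
      first segment at time \<open>b n + N\<close>, exactly \<open>P\<close> steps after being
      \<eta>-close to it at time \<open>a 1\<close>.\<close>
    obtain y where y: "y \<in> X" "(f ^^ (b n + N)) y = (f ^^ a 1) (x 1)" "shadows f \<eta> n a b x y"
      using shadow_with_endpoint[OF locally_eventually_onto_imp_surj[OF assms(5,2)] _ N(2) spec
          funpow_in[OF x1(1)]] \<eta> \<rho> by fastforce
    \<comment> \<open>Time is shifted by \<open>a 1\<close>, so that the loop to be closed starts at
      \<open>t\<close> and has length \<open>P\<close>.\<close>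
    define t where "t = (f ^^ a 1) y"
    have "t \<in> X" using y(1) funpow_in by (simp add: t_def)
    have t_later: "(f ^^ (k - a 1)) t = (f ^^ k) y" if "a 1 \<le> k" for k
      using that funpow_add[of "k - a 1" "a 1" f] by (simp add: t_def)
    have "(f ^^ P) t = (f ^^ a 1) (x 1)"
      using t_later[of "b n + N"] ab y(2) by (simp add: P_def)
    moreover have "dist t ((f ^^ a 1) (x 1)) \<le> \<eta>"
      using y(3) one x1(2) by (auto simp: shadows_def t_def)
    ultimately have "dist ((f ^^ P) t) t \<le> \<rho> * (1 - 1 / l)"
      by (simp add: dist_commute \<eta>_def)
    then obtain z where z: "z \<in> X" "(f ^^ P) z = z"
      "\<And>j. j \<le> P \<Longrightarrow> dist ((f ^^ j) t) ((f ^^ j) z) \<le> \<rho>"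
      using closing[OF compact_imp_complete[OF assms(1)] \<open>t \<in> X\<close> \<open>0 < P\<close> \<rho>(1,2)] by blast
    \<comment> \<open>\<open>z\<close> belongs to time \<open>a 1\<close>; going back to time \<open>0\<close> uses that its orbit is periodic.\<close>
    define w where "w = (f ^^ (a 1 * P - a 1)) z"
    have "w \<in> X" using z(1) funpow_in by (simp add: w_def)
    have "a 1 \<le> a 1 * P" using \<open>0 < P\<close> by simp
    have per: "(f ^^ (k * P)) z = z" for k
      by (induction k) (use z(2) in \<open>auto simp: funpow_add\<close>)
    have "(f ^^ (a 1 + (a 1 * P - a 1))) z = z"
      by (simp only: le_add_diff_inverse[OF \<open>a 1 \<le> a 1 * P\<close>] per)
    then have w_at_a: "(f ^^ a 1) w = z"
      by (simp add: w_def funpow_add)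
    have w_later: "(f ^^ k) w = (f ^^ (k - a 1)) z" if "a 1 \<le> k" for k
      using that funpow_add[of "k - a 1" "a 1" f] w_at_a by simp
    \<comment> \<open>\<open>w\<close> lies on the orbit of \<open>z\<close>, and iterates of
      \<open>f\<close> commute.\<close>
    have "(f ^^ P) w = w"
      using z(2) by (metis w_def add.commute comp_apply funpow_add)
    moreover have "shadows f \<epsilon> n a b x w"
      unfolding shadows_def
    proof (intro ballI)
      fix i k assume i: "i \<in> {1..n}" and k: "k \<in> {a i..b i}"
      \<comment> \<open>After the shift, the window from \<open>a 1\<close> to \<open>b n\<close>
        lies within the \<open>P\<close> steps controlled by \<open>closing\<close>.\<close>
      have "a 1 \<le> k" "k - a 1 \<le> P" using bounds[OF i] k by (auto simp: P_def)
      then have "dist ((f ^^ k) y) ((f ^^ k) w) \<le> \<rho>"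
        using z(3) t_later w_later by metis
      moreover have "dist ((f ^^ k) y) ((f ^^ k) (x i)) \<le> \<eta>"
        using y(3) i k by (auto simp: shadows_def)
      ultimately show "dist ((f ^^ k) w) ((f ^^ k) (x i)) \<le> \<epsilon>"
        using dist_triangle3[of "(f ^^ k) w" "(f ^^ k) (x i)" "(f ^^ k) y"] \<eta>(2) \<rho>(3) by linarith
    qed
    ultimately show "\<exists>y\<in>X. shadows f \<epsilon> n a b x y \<and> (f ^^ (b n - a 1 + N)) y = y"
      using \<open>w \<in> X\<close> by (auto simp: P_def)
  qed
qed

end
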